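(* Let $G$ be a compact (Hausdorff) group with normalized Haar measure $\mathbf{m}$, and let $\alpha$ be an automorphism of $G$ with $\alpha^3=\mathrm{id}$ such that the set $X=\{x\in G : x x^{\alpha} x^{\alpha^2}=1\}$ is measurable and $\mathbf{m}(X)>\frac{15}{16}$. Then $X=G$.
   Context: $x^\alpha$ denotes the image of $x$ under $\alpha$. *)

theory Defs
  imports "HOL-Analysis.Analysis" "HOL-Algebra.Group" "HOL-Algebra.Coset"
begin

definition compact_hausdorff_group :: "('a, 'b) monoid_scheme \<Rightarrow> 'a topology \<Rightarrow> bool" where
  "compact_hausdorff_group G T \<longleftrightarrow>
     group G \<and> topspace T = carrier G \<and> Hausdorff_space T \<and> compact_space T \<and>
     continuous_map (prod_topology T T) T (\<lambda>(x, y). x \<otimes>\<^bsub>G\<^esub> y) \<and>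
     continuous_map T T (\<lambda>x. inv\<^bsub>G\<^esub> x)"

definition borel_sets_of :: "'a topology \<Rightarrow> 'a set set" where
  "borel_sets_of T = sigma_sets (topspace T) {U. openin T U}"

text \<open>Normalized Haar measure of a compact group: a probability measure on the carrier,
  defined (at least) on all Borel sets, invariant under left and right translations,
  and regular (outer regular by open sets, inner regular by compact sets).
  Its measurable sets may include more than the Borel sets (e.g. the completion).\<close>
definition normalized_haar_measure ::
    "('a, 'b) monoid_scheme \<Rightarrow> 'a topology \<Rightarrow> 'a measure \<Rightarrow> bool" where
  "normalized_haar_measure G T m \<longleftrightarrow>
     emeasure m (space m) = 1 \<and> space m = carrier G \<and> borel_sets_of T \<subseteq> sets m \<and>
     (\<forall>A \<in> sets m. \<forall>g \<in> carrier G.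
        g <#\<^bsub>G\<^esub> A \<in> sets m \<and> emeasure m (g <#\<^bsub>G\<^esub> A) = emeasure m A \<and>
        A #>\<^bsub>G\<^esub> g \<in> sets m \<and> emeasure m (A #>\<^bsub>G\<^esub> g) = emeasure m A) \<and>
     (\<forall>A \<in> sets m.
        emeasure m A = (INF U \<in> {U. openin T U \<and> A \<subseteq> U}. emeasure m U) \<and>
        emeasure m A = (SUP K \<in> {K. compactin T K \<and> K \<subseteq> A}. emeasure m K))"

end

theory Submission
  imports Defs "HOL-Algebra.Generated_Groups"
begin

text \<open>
  For an endomorphism \<open>\<beta>\<close> put \<open>N\<^sub>\<beta>(x) = x x\<^sup>\<beta> x\<^sup>\<beta>\<^sup>\<beta>\<close>. If \<open>N\<^sub>\<beta>(k) = N\<^sub>\<beta>(k\<^sup>-\<^sup>1) = 1\<close>, then \<open>k\<close> commutes with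
  \<open>k\<^sup>\<beta>\<close>; and if \<open>N\<^sub>\<alpha>(b) = 1\<close>, then \<open>N\<^sub>\<alpha>(x b) = N\<^sub>\<beta>(x)\<close>, where \<open>\<beta>\<close> is \<open>\<alpha>\<close> followed by conjugation by \<open>b\<close>.
  Because \<open>X\<close> has large measure, any nine of its left translates have a common point \<open>b\<close>, and nine
  conditions \<open>f b \<in> X\<close> force the 2-Engel identity \<open>[k, [k, z]] = 1\<close>; hence \<open>G\<close> is nilpotent of
  class at most 3 (Levi). A homomorphism that is constant on generic arguments is trivial, so \<open>g\<close>
  commutes with all conjugates of \<open>g\<^sup>\<alpha>\<close>, and the conjugates of \<open>g, g\<^sup>\<alpha>, g\<^sup>\<alpha>\<^sup>\<alpha>\<close> lie in one abelian
  normal subgroup. For generic \<open>x\<close> the product \<open>g \<cdot> x g\<^sup>\<alpha> x\<^sup>-\<^sup>1 \<cdot> x x\<^sup>\<alpha> g\<^sup>\<alpha>\<^sup>\<alpha> (x x\<^sup>\<alpha>)\<^sup>-\<^sup>1\<close> equals \<open>N\<^sub>\<alpha>(g x) = 1\<close>.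
  It is a quadratic function of \<open>x\<close>, so it is trivial at \<open>x = 1\<close> too, which says that \<open>g \<in> X\<close>.
\<close>

section \<open>Conjugates and commutators\<close>

context group
begin

definition conjugate :: "'a \<Rightarrow> 'a \<Rightarrow> 'a" where
  "conjugate x a = x \<otimes> a \<otimes> inv x"

definition commutator :: "'a \<Rightarrow> 'a \<Rightarrow> 'a" where
  "commutator x y = x \<otimes> y \<otimes> inv x \<otimes> inv y"

lemma inv_mult_cancel:
  assumes "x \<in> carrier G" "y \<in> carrier G"
  shows "inv x \<otimes> (x \<otimes> y) = y" "x \<otimes> (inv x \<otimes> y) = y"
  using assms by (simp_all add: m_assoc[symmetric])

lemma eq_inv_of_mult_eq_one:
  "x \<in> carrier G \<Longrightarrow> y \<in> carrier G \<Longrightarrow> x \<otimes> y = \<one> \<Longrightarrow> y = inv x"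
  using inv_comm inv_equality by metis

lemmas word_simps = m_assoc inv_mult_group inv_mult_cancel

lemma conjugate_closed [simp]:
  "x \<in> carrier G \<Longrightarrow> a \<in> carrier G \<Longrightarrow> conjugate x a \<in> carrier G"
  unfolding conjugate_def by simp

lemma commutator_closed [simp]:
  "x \<in> carrier G \<Longrightarrow> y \<in> carrier G \<Longrightarrow> commutator x y \<in> carrier G"
  unfolding commutator_def by simp

lemma conjugate_hom: "x \<in> carrier G \<Longrightarrow> conjugate x \<in> hom G G"
  by (intro homI) (simp_all add: conjugate_def word_simps)

lemma conjugate_one_left [simp]: "a \<in> carrier G \<Longrightarrow> conjugate \<one> a = a"
  unfolding conjugate_def by simp

lemma conjugate_one_right [simp]: "x \<in> carrier G \<Longrightarrow> conjugate x \<one> = \<one>"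
  unfolding conjugate_def by simp

lemma conjugate_mult_left:
  "x \<in> carrier G \<Longrightarrow> y \<in> carrier G \<Longrightarrow> a \<in> carrier G
    \<Longrightarrow> conjugate (x \<otimes> y) a = conjugate x (conjugate y a)"
  unfolding conjugate_def by (simp add: word_simps)

lemma conjugate_mult_right:
  "x \<in> carrier G \<Longrightarrow> a \<in> carrier G \<Longrightarrow> b \<in> carrier G
    \<Longrightarrow> conjugate x (a \<otimes> b) = conjugate x a \<otimes> conjugate x b"
  unfolding conjugate_def by (simp add: word_simps)

lemma conjugate_eq_commutator_mult:
  "x \<in> carrier G \<Longrightarrow> a \<in> carrier G \<Longrightarrow> conjugate x a = commutator x a \<otimes> a"
  unfolding conjugate_def commutator_def by (simp add: word_simps)

lemma commutator_eq_conjugate_mult: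
  "x \<in> carrier G \<Longrightarrow> a \<in> carrier G \<Longrightarrow> commutator x a = conjugate x a \<otimes> inv a"
  unfolding conjugate_def commutator_def by (simp add: word_simps)

lemma inv_commutator:
  "x \<in> carrier G \<Longrightarrow> y \<in> carrier G \<Longrightarrow> inv (commutator x y) = commutator y x"
  unfolding commutator_def by (simp add: word_simps)

lemma commutator_eq_one_iff:
  assumes "x \<in> carrier G" "y \<in> carrier G"
  shows "commutator x y = \<one> \<longleftrightarrow> x \<otimes> y = y \<otimes> x"
proof -
  have "commutator x y = x \<otimes> y \<otimes> inv (y \<otimes> x)"
    unfolding commutator_def using assms by (simp add: word_simps)
  then show ?thesis using assms by (simp add: inv_solve_right')
qed

lemma conjugate_eq_self_iff:
  "x \<in> carrier G \<Longrightarrow> a \<in> carrier G \<Longrightarrow> conjugate x a = a \<longleftrightarrow> commutator x a = \<one>"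
  unfolding conjugate_eq_commutator_mult by (metis commutator_closed l_one one_closed right_cancel)

lemma commutator_mult_left:
  "x \<in> carrier G \<Longrightarrow> y \<in> carrier G \<Longrightarrow> a \<in> carrier G
    \<Longrightarrow> commutator (x \<otimes> y) a = commutator x (commutator y a) \<otimes> commutator y a \<otimes> commutator x a"
  unfolding commutator_def by (simp add: word_simps)

lemma commutator_mult_right:
  "x \<in> carrier G \<Longrightarrow> a \<in> carrier G \<Longrightarrow> b \<in> carrier G
    \<Longrightarrow> commutator x (a \<otimes> b) = commutator x a \<otimes> conjugate a (commutator x b)"
  unfolding commutator_def conjugate_def by (simp add: word_simps)

lemma commute_conjugate_iff:
  assumes "x \<in> carrier G" "a \<in> carrier G" "b \<in> carrier G"
  shows "a \<otimes> conjugate x b = conjugate x b \<otimes> a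
    \<longleftrightarrow> conjugate (inv x) a \<otimes> b = b \<otimes> conjugate (inv x) a"
proof -
  have "conjugate x (conjugate (inv x) a \<otimes> b) = a \<otimes> conjugate x b"
    "conjugate x (b \<otimes> conjugate (inv x) a) = conjugate x b \<otimes> a"
    unfolding conjugate_def using assms by (simp_all add: word_simps)
  moreover have "conjugate x c = conjugate x d \<longleftrightarrow> c = d" if "c \<in> carrier G" "d \<in> carrier G" for c d
    unfolding conjugate_def using assms that by simp
  ultimately show ?thesis using assms by (metis conjugate_closed inv_closed m_closed)
qed

lemma commute_inv_iff:
  assumes "x \<in> carrier G" "y \<in> carrier G"
  shows "x \<otimes> inv y = inv y \<otimes> x \<longleftrightarrow> x \<otimes> y = y \<otimes> x"
proof -
  have "x \<otimes> inv y = inv y \<otimes> x \<longleftrightarrow> x = y \<otimes> x \<otimes> inv y"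
    using inv_solve_left[of "x \<otimes> inv y" y x] assms by (simp add: m_assoc)
  also have "\<dots> \<longleftrightarrow> x \<otimes> y = y \<otimes> x"
    using inv_solve_right[of x "y \<otimes> x" y] assms by auto
  finally show ?thesis .
qed

lemma conjugates_commute:
  assumes carrier: "x \<in> carrier G" "y \<in> carrier G" "a \<in> carrier G" "b \<in> carrier G"
    and commute: "\<And>z. z \<in> carrier G \<Longrightarrow> a \<otimes> conjugate z b = conjugate z b \<otimes> a"
  shows "conjugate x a \<otimes> conjugate y b = conjugate y b \<otimes> conjugate x a"
proof -
  have "a \<otimes> conjugate (inv x) (conjugate y b) = conjugate (inv x) (conjugate y b) \<otimes> a"
    using commute[of "inv x \<otimes> y"] carrier by (simp add: conjugate_mult_left)
  then show ?thesis
    using carrier commute_conjugate_iff[of "inv x" a "conjugate y b"] by simp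
qed

lemma commutator_self_left_eq_one_iff:
  assumes "x \<in> carrier G" "y \<in> carrier G"
  shows "commutator x (commutator x y) = \<one> \<longleftrightarrow> x \<otimes> conjugate y x = conjugate y x \<otimes> x"
proof -
  let ?c = "conjugate y x"
  have c: "?c \<in> carrier G" using assms by simp
  have "commutator x y = x \<otimes> inv ?c"
    unfolding commutator_def conjugate_def using assms by (simp add: word_simps)
  then have "commutator x (commutator x y) = \<one> \<longleftrightarrow> x \<otimes> (x \<otimes> inv ?c) = x \<otimes> (inv ?c \<otimes> x)"
    using assms c by (simp add: commutator_eq_one_iff m_assoc)
  also have "\<dots> \<longleftrightarrow> x \<otimes> inv ?c = inv ?c \<otimes> x"
    using assms c by simp
  also have "\<dots> \<longleftrightarrow> x \<otimes> ?c = ?c \<otimes> x"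
    using assms c by (simp add: commute_inv_iff)
  finally show ?thesis .
qed

lemma generate_commute:
  assumes "D \<subseteq> carrier G" "x \<in> carrier G" "\<And>d. d \<in> D \<Longrightarrow> x \<otimes> d = d \<otimes> x" "a \<in> generate G D"
  shows "x \<otimes> a = a \<otimes> x"
  using assms(4)
proof (induction a rule: generate.induct)
  case (inv d)
  then show ?case
    using assms by (simp add: commute_inv_iff subset_iff)
next
  case (eng a b)
  then show ?case
    using assms(1,2) generate_in_carrier by (metis m_assoc)
qed (use assms in simp_all)

lemma generate_abelian:
  assumes D: "D \<subseteq> carrier G" and commute: "\<And>d e. d \<in> D \<Longrightarrow> e \<in> D \<Longrightarrow> d \<otimes> e = e \<otimes> d"
    and ab: "a \<in> generate G D" "b \<in> generate G D"
  shows "a \<otimes> b = b \<otimes> a"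
proof (rule generate_commute[OF D _ _ ab(2)])
  show "a \<otimes> d = d \<otimes> a" if "d \<in> D" for d
    using generate_commute[OF D _ commute[OF that] ab(1)] D that by auto
qed (use D ab generate_in_carrier in blast)

end

lemma (in group_hom) hom_conjugate:
  "x \<in> carrier G \<Longrightarrow> a \<in> carrier G \<Longrightarrow> h (G.conjugate x a) = H.conjugate (h x) (h a)"
  unfolding G.conjugate_def H.conjugate_def by simp

locale abelian_normal = normal +
  assumes commute: "a \<in> H \<Longrightarrow> b \<in> H \<Longrightarrow> a \<otimes> b = b \<otimes> a"
begin

lemma comm_group_subgroup: "comm_group (G\<lparr>carrier := H\<rparr>)"
  by (rule group.group_comm_groupI[OF subgroup_is_group[OF is_group]]) (simp add: commute)

lemma conjugate_mem: "x \<in> carrier G \<Longrightarrow> a \<in> H \<Longrightarrow> conjugate x a \<in> H"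
  unfolding conjugate_def by (rule inv_op_closed2)

lemma commutator_mem: "x \<in> carrier G \<Longrightarrow> a \<in> H \<Longrightarrow> commutator x a \<in> H"
  by (simp add: commutator_eq_conjugate_mult conjugate_mem)

lemma commutator_hom:
  assumes "x \<in> carrier G"
  shows "commutator x \<in> hom (G\<lparr>carrier := H\<rparr>) (G\<lparr>carrier := H\<rparr>)"
proof (intro homI)
  fix a b assume "a \<in> carrier (G\<lparr>carrier := H\<rparr>)" "b \<in> carrier (G\<lparr>carrier := H\<rparr>)"
  then have ab: "a \<in> H" "b \<in> H" by simp_all
  then have "conjugate a (commutator x b) = commutator x b"
    using commute[of a "commutator x b"] commutator_mem[OF assms] assms
    by (simp add: conjugate_eq_self_iff commutator_eq_one_iff)
  then show "commutator x (a \<otimes>\<^bsub>G\<lparr>carrier := H\<rparr>\<^esub> b)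
      = commutator x a \<otimes>\<^bsub>G\<lparr>carrier := H\<rparr>\<^esub> commutator x b"
    using assms ab by (simp add: commutator_mult_right)
qed (use assms in \<open>simp add: commutator_mem\<close>)

end

lemma (in group) ex_abelian_normal:
  assumes S: "S \<subseteq> carrier G"
    and commute: "\<And>x a b. x \<in> carrier G \<Longrightarrow> a \<in> S \<Longrightarrow> b \<in> S
      \<Longrightarrow> a \<otimes> conjugate x b = conjugate x b \<otimes> a"
  shows "\<exists>A. abelian_normal A G \<and> S \<subseteq> A"
proof -
  define D where "D = (\<Union>x\<in>carrier G. conjugate x ` S)"
  have D: "D \<subseteq> carrier G" unfolding D_def using S by auto
  have D_commute: "d \<otimes> e = e \<otimes> d" if "d \<in> D" "e \<in> D" for d e
    using that S commute unfolding D_def by (auto intro!: conjugates_commute)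
  have "generate G D \<lhd> G"
  proof (rule normal_generateI[OF D])
    fix d g assume "d \<in> D" and g: "g \<in> carrier G"
    then obtain x a where "d = conjugate x a" "x \<in> carrier G" "a \<in> S" unfolding D_def by auto
    then have "conjugate g d = conjugate (g \<otimes> x) a"
      using S g by (auto simp: conjugate_mult_left)
    then show "g \<otimes> d \<otimes> inv g \<in> D"
      unfolding D_def conjugate_def[symmetric] using \<open>x \<in> carrier G\<close> \<open>a \<in> S\<close> g by auto
  qed
  moreover have "a \<otimes> b = b \<otimes> a" if "a \<in> generate G D" "b \<in> generate G D" for a b
    using generate_abelian[OF D D_commute that] .
  moreover have "S \<subseteq> generate G D"
  proof
    fix a assume "a \<in> S"
    then have "conjugate \<one> a \<in> D" unfolding D_def by blast
    then show "a \<in> generate G D" using \<open>a \<in> S\<close> S generate.incl by fastforce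
  qed
  ultimately show ?thesis
    by (intro exI[of _ "generate G D"]) (simp add: abelian_normal_def abelian_normal_axioms_def)
qed

lemma (in comm_group) square_trivial_endomorphisms_anticommute:
  assumes uv: "u \<in> hom G G" "v \<in> hom G G"
    and u: "\<And>a. a \<in> carrier G \<Longrightarrow> u (u a) = \<one>"
    and v: "\<And>a. a \<in> carrier G \<Longrightarrow> v (v a) = \<one>"
    and w: "\<And>a. a \<in> carrier G \<Longrightarrow> w (w a) = \<one>"
    and w_eq: "\<And>a. a \<in> carrier G \<Longrightarrow> w a = u (v a) \<otimes> v a \<otimes> u a"
    and a: "a \<in> carrier G"
  shows "u (v a) \<otimes> v (u a) = \<one>"
proof -
  interpret u: group_hom G G u using uv by unfold_locales
  interpret v: group_hom G G v using uv by unfold_locales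
  have w_w: "u (v (u (v a))) \<otimes> u (v (u a)) \<otimes> v (u (v a)) \<otimes> v (u a) \<otimes> u (v a) = \<one>"
    using w[OF a] a by (simp add: w_eq u v m_assoc)
  from arg_cong[OF this, of u] have "u (v (u (v a))) \<otimes> u (v (u a)) = \<one>"
    using a by (simp add: u)
  with w_w have v_u_v: "v (u (v a)) \<otimes> v (u a) \<otimes> u (v a) = \<one>"
    using a by simp
  from arg_cong[OF this, of v] have "v (u (v a)) = \<one>"
    using a by (simp add: v)
  with v_u_v show ?thesis using a by (simp add: m_comm)
qed

section \<open>2-Engel groups\<close>

locale two_engel_group = group +
  assumes engel: "x \<in> carrier G \<Longrightarrow> y \<in> carrier G \<Longrightarrow> commutator x (commutator x y) = \<one>"
begin

lemma commute_conjugate: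
  "x \<in> carrier G \<Longrightarrow> y \<in> carrier G \<Longrightarrow> x \<otimes> conjugate y x = conjugate y x \<otimes> x"
  using engel commutator_self_left_eq_one_iff by blast

lemma abelian_normal_containing:
  assumes "a \<in> carrier G"
  obtains A where "abelian_normal A G" "a \<in> A"
  using ex_abelian_normal[of "{a}"] assms commute_conjugate by auto

lemma commutator_inv_right:
  assumes "x \<in> carrier G" "a \<in> carrier G"
  shows "commutator x (inv a) = inv (commutator x a)"
proof -
  obtain A where "abelian_normal A G" "a \<in> A" using abelian_normal_containing assms by blast
  then interpret A: abelian_normal A G by simp
  interpret group_hom "G\<lparr>carrier := A\<rparr>" "G\<lparr>carrier := A\<rparr>" "commutator x"
    using A.commutator_hom A.comm_group_subgroup assms
    by (simp add: group_hom_def group_hom_axioms_def comm_group_def)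
  show ?thesis
    using hom_inv[of a] \<open>a \<in> A\<close> assms A.commutator_mem by (simp add: A.subgroup_axioms)
qed

lemma commutator_inv_left:
  assumes "x \<in> carrier G" "a \<in> carrier G"
  shows "commutator (inv x) a = inv (commutator x a)"
  using commutator_inv_right[of a x] assms by (metis inv_closed inv_commutator commutator_closed)

lemma double_commutator_swap_left:
  assumes "x \<in> carrier G" "y \<in> carrier G" "a \<in> carrier G"
  shows "commutator x (commutator y a) = inv (commutator y (commutator x a))"
proof -
  obtain A where "abelian_normal A G" "a \<in> A" using abelian_normal_containing assms by blast
  then interpret A: abelian_normal A G by simp
  interpret comm_A: comm_group "G\<lparr>carrier := A\<rparr>" by (rule A.comm_group_subgroup)
  have "commutator x (commutator y a) \<otimes>\<^bsub>G\<lparr>carrier := A\<rparr>\<^esub> commutator y (commutator x a)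
      = \<one>\<^bsub>G\<lparr>carrier := A\<rparr>\<^esub>"
    by (rule comm_A.square_trivial_endomorphisms_anticommute[where w = "commutator (x \<otimes> y)"])
      (use assms \<open>a \<in> A\<close> in \<open>auto simp: A.commutator_hom engel intro: commutator_mult_left\<close>)
  then show ?thesis using assms by (simp add: inv_equality)
qed

lemma double_commutator_swap_right:
  assumes "x \<in> carrier G" "y \<in> carrier G" "a \<in> carrier G"
  shows "commutator x (commutator y a) = inv (commutator x (commutator a y))"
  using commutator_inv_right[of x "commutator a y"] assms by (simp add: inv_commutator)

lemma double_commutator_rotate:
  assumes "x \<in> carrier G" "y \<in> carrier G" "a \<in> carrier G"
  shows "commutator x (commutator y a) = commutator a (commutator x y)"
  using double_commutator_swap_right[of x y a] double_commutator_swap_left[of x a y] assms by simp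

text \<open>\<open>x \<otimes> y\<close> and \<open>y \<otimes> x\<close> differ by \<open>[x\<^sup>-\<^sup>1, y\<^sup>-\<^sup>1] = [x, y]\<close>; compare their actions on \<open>a\<close>.\<close>

lemma commutator_commutator_left:
  assumes "x \<in> carrier G" "y \<in> carrier G" "a \<in> carrier G"
  shows "commutator (commutator x y) a
    = commutator x (commutator y a) \<otimes> commutator x (commutator y a)"
proof -
  define p where "p = commutator x (commutator y a)"
  have [simp]: "p \<in> carrier G" unfolding p_def using assms by simp
  have swap: "commutator y (commutator x a) = inv p"
    unfolding p_def using double_commutator_swap_left[of y x a] assms by simp
  obtain A where "abelian_normal A G" "a \<in> A" using abelian_normal_containing assms by blast
  then interpret A: abelian_normal A G by simp
  have "commutator x p = \<one>"
    unfolding p_def using engel assms by simp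
  moreover have "commutator y (inv p) = \<one>"
    unfolding swap[symmetric] using engel assms by simp
  then have "commutator y p = \<one>"
    using commutator_inv_right[of y p] assms by simp
  ultimately have "conjugate x p = p" "conjugate y p = p"
    using assms by (simp_all add: conjugate_eq_self_iff)
  then have fixed: "conjugate (y \<otimes> x) (p \<otimes> p) = p \<otimes> p"
    using assms by (simp add: conjugate_mult_left conjugate_mult_right)
  have "conjugate (y \<otimes> x) (commutator (commutator x y) a)
      = conjugate (y \<otimes> x) (commutator (commutator (inv x) (inv y)) a)"
    using assms by (simp add: commutator_inv_left commutator_inv_right)
  also have "\<dots> = commutator (x \<otimes> y) a \<otimes> inv (commutator (y \<otimes> x) a)"
    unfolding conjugate_def commutator_def using assms by (simp add: word_simps)
  also have "\<dots> = p \<otimes> (commutator y a \<otimes> commutator x a)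
      \<otimes> inv (inv p \<otimes> (commutator x a \<otimes> commutator y a))"
    using assms p_def swap by (simp add: commutator_mult_left m_assoc)
  also have "commutator y a \<otimes> commutator x a = commutator x a \<otimes> commutator y a"
    using A.commute A.commutator_mem assms \<open>a \<in> A\<close> by blast
  also have "p \<otimes> (commutator x a \<otimes> commutator y a)
      \<otimes> inv (inv p \<otimes> (commutator x a \<otimes> commutator y a)) = p \<otimes> p"
    using assms by (simp add: word_simps)
  also note fixed[symmetric]
  finally show ?thesis
    unfolding conjugate_def p_def[symmetric] using assms by simp
qed

lemma double_commutator_cube:
  assumes "x \<in> carrier G" "y \<in> carrier G" "a \<in> carrier G"
  defines "p \<equiv> commutator x (commutator y a)"
  shows "p \<otimes> p \<otimes> p = \<one>"
proof -
  have "inv p = commutator (commutator x y) a"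
    unfolding p_def using double_commutator_rotate[of x y a] assms(1-3) by (simp add: inv_commutator)
  also have "\<dots> = p \<otimes> p"
    unfolding p_def by (rule commutator_commutator_left) (use assms(1-3) in simp_all)
  finally show ?thesis
    using l_inv[of p] unfolding p_def using assms(1-3) by simp
qed

text \<open>The triple commutator is alternating in its four arguments, and rotating a double commutator of
  commutators shows that the even permutation \<open>(x y z w) \<mapsto> (z w x y)\<close> inverts it: it is killed
  by 2, and by 3.\<close>

theorem triple_commutator_eq_one:
  assumes "x \<in> carrier G" "y \<in> carrier G" "z \<in> carrier G" "w \<in> carrier G"
  shows "commutator x (commutator y (commutator z w)) = \<one>"
proof -
  define q where "q x y z w = commutator x (commutator y (commutator z w))" for x y z w
  have swap12: "q x y z w = inv (q y x z w)"
    if "x \<in> carrier G" "y \<in> carrier G" "z \<in> carrier G" "w \<in> carrier G" for x y z w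
    unfolding q_def using that by (intro double_commutator_swap_left) simp_all
  have swap23: "q x y z w = inv (q x z y w)"
    if "x \<in> carrier G" "y \<in> carrier G" "z \<in> carrier G" "w \<in> carrier G" for x y z w
    unfolding q_def using that commutator_inv_right[of x "commutator z (commutator y w)"]
    by (simp add: double_commutator_swap_left[of y z w])
  have swap34: "q x y z w = inv (q x y w z)"
    if "x \<in> carrier G" "y \<in> carrier G" "z \<in> carrier G" "w \<in> carrier G" for x y z w
    unfolding q_def using that commutator_inv_right[of x "commutator y (commutator w z)"]
    by (simp add: double_commutator_swap_right[of y z w])
  have q [simp]: "q x y z w \<in> carrier G"
    if "x \<in> carrier G" "y \<in> carrier G" "z \<in> carrier G" "w \<in> carrier G" for x y z w
    unfolding q_def using that by simp
  have "q x y z w = commutator (commutator z w) (commutator x y)"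
    unfolding q_def by (rule double_commutator_rotate) (use assms in simp_all)
  also have "\<dots> = inv (commutator (commutator x y) (commutator z w))"
    using assms by (simp add: inv_commutator)
  also have "\<dots> = inv (q z w x y)"
    unfolding q_def using double_commutator_rotate[of z w "commutator x y"] assms by simp
  also have "q z w x y = q x y z w"
    using swap23[of z w x y] swap12[of z x w y] swap34[of x z w y] swap23[of x z y w] assms by simp
  finally have "q x y z w \<otimes> q x y z w = \<one>"
    using assms by (metis l_inv q)
  moreover have "q x y z w \<otimes> q x y z w \<otimes> q x y z w = \<one>"
    unfolding q_def using double_commutator_cube[of x y "commutator z w"] assms by simp
  ultimately show ?thesis unfolding q_def using assms by simp
qed

lemma double_commutator_mult_left:
  assumes "x \<in> carrier G" "y \<in> carrier G" "z \<in> carrier G" "a \<in> carrier G"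
  shows "commutator (x \<otimes> y) (commutator z a)
    = commutator x (commutator z a) \<otimes> commutator y (commutator z a)"
proof -
  have "commutator y (commutator z a) \<otimes> commutator x (commutator z a)
      = commutator x (commutator z a) \<otimes> commutator y (commutator z a)"
    using triple_commutator_eq_one[of "commutator y (commutator z a)" x z a] assms
    by (simp add: commutator_eq_one_iff)
  then show ?thesis
    using triple_commutator_eq_one[of x y z a] assms by (simp add: commutator_mult_left)
qed

lemma double_commutator_mult_middle:
  assumes "x \<in> carrier G" "y \<in> carrier G" "z \<in> carrier G" "a \<in> carrier G"
  shows "commutator x (commutator (y \<otimes> z) a)
    = commutator x (commutator y a) \<otimes> commutator x (commutator z a)"
proof -
  have "commutator x (commutator u a) = commutator u (commutator a x)" if "u \<in> carrier G" for u
    using double_commutator_rotate[of x u a] double_commutator_rotate[of a x u] assms that by simp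
  then show ?thesis
    using double_commutator_mult_left[of y z a x] assms by simp
qed

end

section \<open>Quadratic maps into abelian groups\<close>

text \<open>The third difference of \<open>f\<close> vanishes, written without inverses.\<close>

definition quadratic_map ::
    "('a, 'c) monoid_scheme \<Rightarrow> ('b, 'd) monoid_scheme \<Rightarrow> ('a \<Rightarrow> 'b) \<Rightarrow> bool" where
  "quadratic_map G A f \<longleftrightarrow> f \<in> carrier G \<rightarrow> carrier A \<and>
     (\<forall>x\<in>carrier G. \<forall>y\<in>carrier G. \<forall>z\<in>carrier G.
        f (x \<otimes>\<^bsub>G\<^esub> y \<otimes>\<^bsub>G\<^esub> z) \<otimes>\<^bsub>A\<^esub> f x \<otimes>\<^bsub>A\<^esub> f y \<otimes>\<^bsub>A\<^esub> f z
      = f (x \<otimes>\<^bsub>G\<^esub> y) \<otimes>\<^bsub>A\<^esub> f (x \<otimes>\<^bsub>G\<^esub> z) \<otimes>\<^bsub>A\<^esub> f (y \<otimes>\<^bsub>G\<^esub> z) \<otimes>\<^bsub>A\<^esub> f \<one>\<^bsub>G\<^esub>)"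

definition bimultiplicative ::
    "('a, 'c) monoid_scheme \<Rightarrow> ('b, 'd) monoid_scheme \<Rightarrow> ('a \<Rightarrow> 'a \<Rightarrow> 'b) \<Rightarrow> bool" where
  "bimultiplicative G A T \<longleftrightarrow>
     (\<forall>x\<in>carrier G. T x \<in> hom G A \<and> (\<lambda>y. T y x) \<in> hom G A)"

lemma bimultiplicative_closed:
  "bimultiplicative G A T \<Longrightarrow> x \<in> carrier G \<Longrightarrow> y \<in> carrier G \<Longrightarrow> T x y \<in> carrier A"
  unfolding bimultiplicative_def hom_def by blast

lemma bimultiplicative_mult:
  assumes "bimultiplicative G A T" "x \<in> carrier G" "y \<in> carrier G" "z \<in> carrier G"
  shows "T (x \<otimes>\<^bsub>G\<^esub> y) z = T x z \<otimes>\<^bsub>A\<^esub> T y z"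
    and "T x (y \<otimes>\<^bsub>G\<^esub> z) = T x y \<otimes>\<^bsub>A\<^esub> T x z"
  using assms unfolding bimultiplicative_def hom_def by blast+

lemma bimultiplicative_comp_right:
  assumes "\<tau> \<in> hom G G" "bimultiplicative G A T"
  shows "bimultiplicative G A (\<lambda>x y. T x (\<tau> y))"
  unfolding bimultiplicative_def
proof (intro ballI conjI)
  fix x assume "x \<in> carrier G"
  then show "(\<lambda>y. T x (\<tau> y)) \<in> hom G A" "(\<lambda>y. T y (\<tau> x)) \<in> hom G A"
    using assms hom_compose[OF assms(1), of "T x" A] hom_in_carrier[OF assms(1)]
    unfolding bimultiplicative_def by (simp_all add: o_def)
qed

lemma (in group) quadratic_map_cong:
  assumes "\<And>x. x \<in> carrier G \<Longrightarrow> f x = h x"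
  shows "quadratic_map G A f \<longleftrightarrow> quadratic_map G A h"
  unfolding quadratic_map_def using assms by (simp add: Pi_iff)

lemma quadratic_map_comp:
  assumes "group_hom G H \<tau>" "quadratic_map H A f"
  shows "quadratic_map G A (\<lambda>x. f (\<tau> x))"
proof -
  interpret group_hom G H \<tau> by fact
  show ?thesis using assms(2) unfolding quadratic_map_def by (simp add: Pi_iff)
qed

context comm_group
begin

lemma quadratic_map_const:
  "a \<in> carrier G \<Longrightarrow> quadratic_map K G (\<lambda>x. a)"
  unfolding quadratic_map_def by simp

lemma quadratic_map_mult:
  assumes "group K" and f: "quadratic_map K G f" and h: "quadratic_map K G h"
  shows "quadratic_map K G (\<lambda>x. f x \<otimes> h x)"
  unfolding quadratic_map_def
proof (intro conjI ballI)
  interpret K: group K by fact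
  have closed [simp]: "f x \<in> carrier G" "h x \<in> carrier G" if "x \<in> carrier K" for x
    using f h that unfolding quadratic_map_def by auto
  then show "(\<lambda>x. f x \<otimes> h x) \<in> carrier K \<rightarrow> carrier G" by simp
  fix x y z assume mem [simp]: "x \<in> carrier K" "y \<in> carrier K" "z \<in> carrier K"
  let ?l = "\<lambda>f. f (x \<otimes>\<^bsub>K\<^esub> y \<otimes>\<^bsub>K\<^esub> z) \<otimes> f x \<otimes> f y \<otimes> f z"
  let ?r = "\<lambda>f. f (x \<otimes>\<^bsub>K\<^esub> y) \<otimes> f (x \<otimes>\<^bsub>K\<^esub> z) \<otimes> f (y \<otimes>\<^bsub>K\<^esub> z) \<otimes> f \<one>\<^bsub>K\<^esub>"
  have "?l (\<lambda>x. f x \<otimes> h x) = ?l f \<otimes> ?l h"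
    by (simp add: m_ac)
  also have "\<dots> = ?r f \<otimes> ?r h"
    using f h mem unfolding quadratic_map_def by metis
  also have "\<dots> = ?r (\<lambda>x. f x \<otimes> h x)"
    by (simp add: m_ac)
  finally show "?l (\<lambda>x. f x \<otimes> h x) = ?r (\<lambda>x. f x \<otimes> h x)" .
qed

lemma quadratic_map_of_polarization:
  assumes "group K" and T: "bimultiplicative K G T"
    and f: "\<And>x. x \<in> carrier K \<Longrightarrow> f x \<in> carrier G"
    and f_mult: "\<And>x y. x \<in> carrier K \<Longrightarrow> y \<in> carrier K
      \<Longrightarrow> f (x \<otimes>\<^bsub>K\<^esub> y) \<otimes> f \<one>\<^bsub>K\<^esub> = f x \<otimes> f y \<otimes> T x y"
  shows "quadratic_map K G f"
  unfolding quadratic_map_def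
proof (intro conjI ballI)
  interpret K: group K by fact
  note [simp] = f bimultiplicative_closed[OF T]
  show "f \<in> carrier K \<rightarrow> carrier G" by simp
  fix x y z assume mem [simp]: "x \<in> carrier K" "y \<in> carrier K" "z \<in> carrier K"
  let ?a = "f \<one>\<^bsub>K\<^esub>" and ?b = "f (x \<otimes>\<^bsub>K\<^esub> y)"
  have "(f (x \<otimes>\<^bsub>K\<^esub> y \<otimes>\<^bsub>K\<^esub> z) \<otimes> f x \<otimes> f y \<otimes> f z) \<otimes> ?a
      = (f (x \<otimes>\<^bsub>K\<^esub> y \<otimes>\<^bsub>K\<^esub> z) \<otimes> ?a) \<otimes> (f x \<otimes> f y \<otimes> f z)"
    by (simp add: m_ac)
  also have "\<dots> = (?b \<otimes> f z \<otimes> (T x z \<otimes> T y z)) \<otimes> (f x \<otimes> f y \<otimes> f z)"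
    by (simp add: f_mult bimultiplicative_mult[OF T])
  also have "\<dots> = ?b \<otimes> (f x \<otimes> f z \<otimes> T x z) \<otimes> (f y \<otimes> f z \<otimes> T y z)"
    by (simp add: m_ac)
  also have "\<dots> = ?b \<otimes> (f (x \<otimes>\<^bsub>K\<^esub> z) \<otimes> ?a) \<otimes> (f (y \<otimes>\<^bsub>K\<^esub> z) \<otimes> ?a)"
    by (simp add: f_mult)
  also have "\<dots> = (?b \<otimes> f (x \<otimes>\<^bsub>K\<^esub> z) \<otimes> f (y \<otimes>\<^bsub>K\<^esub> z) \<otimes> ?a) \<otimes> ?a"
    by (simp add: m_ac)
  finally show "f (x \<otimes>\<^bsub>K\<^esub> y \<otimes>\<^bsub>K\<^esub> z) \<otimes> f x \<otimes> f y \<otimes> f z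
      = ?b \<otimes> f (x \<otimes>\<^bsub>K\<^esub> z) \<otimes> f (y \<otimes>\<^bsub>K\<^esub> z) \<otimes> ?a"
    by simp
qed

lemma quadratic_map_diagonal:
  assumes "group K" and T: "bimultiplicative K G T"
  shows "quadratic_map K G (\<lambda>x. T x x)"
proof (rule quadratic_map_of_polarization[where T = "\<lambda>x y. T x y \<otimes> T y x"])
  interpret K: group K by fact
  note [simp] = bimultiplicative_closed[OF T] bimultiplicative_mult[OF T]
  show "bimultiplicative K G (\<lambda>x y. T x y \<otimes> T y x)"
    unfolding bimultiplicative_def by (auto intro!: homI simp: m_ac)
  have "T \<one>\<^bsub>K\<^esub> \<one>\<^bsub>K\<^esub> = \<one>"
    using T is_group unfolding bimultiplicative_def by (metis K.one_closed K.is_group hom_one)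
  then show "T (x \<otimes>\<^bsub>K\<^esub> y) (x \<otimes>\<^bsub>K\<^esub> y) \<otimes> T \<one>\<^bsub>K\<^esub> \<one>\<^bsub>K\<^esub> = T x x \<otimes> T y y \<otimes> (T x y \<otimes> T y x)"
    if "x \<in> carrier K" "y \<in> carrier K" for x y
    using that by (simp add: m_ac)
qed (use assms in \<open>simp_all add: bimultiplicative_closed\<close>)

end

locale two_engel_abelian_normal = two_engel_group G + abelian_normal A G
  for G (structure) and A
begin

lemma bimultiplicative_double_commutator:
  assumes "a \<in> A"
  shows "bimultiplicative G (G\<lparr>carrier := A\<rparr>) (\<lambda>x y. commutator x (commutator y a))"
  unfolding bimultiplicative_def using assms
  by (auto intro!: homI simp: commutator_mem double_commutator_mult_left double_commutator_mult_middle)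

lemma conjugate_mult_polarization:
  assumes "x \<in> carrier G" "y \<in> carrier G" "a \<in> A"
  shows "conjugate (x \<otimes> y) a \<otimes> a
    = conjugate x a \<otimes> conjugate y a \<otimes> commutator x (commutator y a)"
proof -
  interpret comm_A: comm_group "G\<lparr>carrier := A\<rparr>" by (rule comm_group_subgroup)
  have "commutator x (commutator y a) \<in> A" "commutator y a \<in> A" "commutator x a \<in> A"
    using assms by (simp_all add: commutator_mem)
  then show ?thesis
    using assms comm_A.m_ac
    by (simp add: conjugate_eq_commutator_mult commutator_mult_left)
qed

lemma quadratic_map_conjugate:
  assumes "a \<in> A"
  shows "quadratic_map G (G\<lparr>carrier := A\<rparr>) (\<lambda>x. conjugate x a)"
proof -
  interpret comm_A: comm_group "G\<lparr>carrier := A\<rparr>" by (rule comm_group_subgroup)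
  show ?thesis
    by (rule comm_A.quadratic_map_of_polarization[OF is_group bimultiplicative_double_commutator])
      (use assms conjugate_mult_polarization in \<open>simp_all add: conjugate_mem\<close>)
qed

lemma quadratic_map_conjugate_twist:
  assumes "\<tau> \<in> hom G G" and a: "a \<in> A"
  shows "quadratic_map G (G\<lparr>carrier := A\<rparr>) (\<lambda>x. conjugate (x \<otimes> \<tau> x) a)"
proof -
  interpret comm_A: comm_group "G\<lparr>carrier := A\<rparr>" by (rule comm_group_subgroup)
  interpret \<tau>: group_hom G G \<tau> by unfold_locales fact
  let ?T = "\<lambda>x y. commutator x (commutator (\<tau> y) a)"
  have "quadratic_map G (G\<lparr>carrier := A\<rparr>) (\<lambda>x. conjugate (\<tau> x) a)"
    by (rule quadratic_map_comp[OF \<tau>.group_hom_axioms quadratic_map_conjugate[OF a]])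
  moreover have "quadratic_map G (G\<lparr>carrier := A\<rparr>) (\<lambda>x. ?T x x)"
    using comm_A.quadratic_map_diagonal[OF is_group]
      bimultiplicative_comp_right[OF assms(1) bimultiplicative_double_commutator[OF a]] .
  moreover have "quadratic_map G (G\<lparr>carrier := A\<rparr>) (\<lambda>x. inv a)"
    by (rule comm_A.quadratic_map_const) (simp add: a)
  ultimately have "quadratic_map G (G\<lparr>carrier := A\<rparr>)
      (\<lambda>x. conjugate x a \<otimes> conjugate (\<tau> x) a \<otimes> ?T x x \<otimes> inv a)"
    by (intro comm_A.quadratic_map_mult[OF is_group, simplified] quadratic_map_conjugate[OF a])
  moreover have "conjugate x a \<otimes> conjugate (\<tau> x) a \<otimes> ?T x x \<otimes> inv a = conjugate (x \<otimes> \<tau> x) a"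
    if "x \<in> carrier G" for x
    using that a conjugate_mult_polarization[of x "\<tau> x" a, symmetric] by (simp add: m_assoc)
  ultimately show ?thesis by (simp cong: quadratic_map_cong)
qed

end

section \<open>Twisted cubes\<close>

context group
begin

text \<open>In \<open>G \<rtimes> \<langle>\<beta>\<rangle>\<close>, this is \<open>(x\<beta>)\<^sup>3 \<beta>\<^sup>-\<^sup>3\<close>.\<close>

definition twisted_cube :: "('a \<Rightarrow> 'a) \<Rightarrow> 'a \<Rightarrow> 'a" where
  "twisted_cube \<beta> x = x \<otimes> \<beta> x \<otimes> \<beta> (\<beta> x)"

lemma commute_image_of_twisted_cube:
  assumes "\<beta> \<in> hom G G" and k: "k \<in> carrier G"
    and "twisted_cube \<beta> k = \<one>" "twisted_cube \<beta> (inv k) = \<one>"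
  shows "k \<otimes> \<beta> k = \<beta> k \<otimes> k"
proof -
  interpret group_hom G G \<beta> by unfold_locales fact
  have "inv (\<beta> (\<beta> k) \<otimes> (\<beta> k \<otimes> k)) = \<one>"
    using assms(4) k unfolding twisted_cube_def by (simp add: inv_mult_group)
  then have "\<beta> (\<beta> k) \<otimes> (\<beta> k \<otimes> k) = \<one>"
    using k by simp
  moreover have "(k \<otimes> \<beta> k) \<otimes> \<beta> (\<beta> k) = \<one>"
    using assms(3) unfolding twisted_cube_def .
  ultimately show ?thesis
    using inv_unique[of "k \<otimes> \<beta> k" "\<beta> (\<beta> k)" "\<beta> k \<otimes> k"] k by simp
qed

lemma twisted_cube_conjugate:
  assumes "\<beta> \<in> hom G G" and carrier: "a \<in> carrier G" "b \<in> carrier G" and "twisted_cube \<beta> b = \<one>"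
  shows "twisted_cube (conjugate b \<circ> \<beta>) a = twisted_cube \<beta> (a \<otimes> b)"
proof -
  interpret group_hom G G \<beta> by unfold_locales fact
  have "\<beta> (\<beta> b) = inv (b \<otimes> \<beta> b)"
    using assms(4) carrier unfolding twisted_cube_def by (intro eq_inv_of_mult_eq_one) simp_all
  then show ?thesis
    unfolding twisted_cube_def conjugate_def using carrier by (simp add: word_simps)
qed

lemma conjugate_comp_hom: "\<beta> \<in> hom G G \<Longrightarrow> b \<in> carrier G \<Longrightarrow> conjugate b \<circ> \<beta> \<in> hom G G"
  by (rule Group.hom_compose[OF _ conjugate_hom])

lemma commute_conjugate_of_twisted_cube:
  assumes "\<beta> \<in> hom G G" and carrier: "k \<in> carrier G" "b \<in> carrier G" and "twisted_cube \<beta> b = \<one>"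
    and "twisted_cube \<beta> (k \<otimes> b) = \<one>" "twisted_cube \<beta> (inv k \<otimes> b) = \<one>"
  shows "k \<otimes> conjugate b (\<beta> k) = conjugate b (\<beta> k) \<otimes> k"
  using commute_image_of_twisted_cube[OF conjugate_comp_hom[OF assms(1) carrier(2)] carrier(1)]
    twisted_cube_conjugate[OF assms(1)] assms by simp

lemma commute_image_conjugate_of_twisted_cube:
  assumes "\<beta> \<in> hom G G" and carrier: "k \<in> carrier G" "z \<in> carrier G"
    and "twisted_cube \<beta> (inv z) = \<one>"
    and "twisted_cube \<beta> (k \<otimes> inv z) = \<one>" "twisted_cube \<beta> (inv k \<otimes> inv z) = \<one>"
  shows "conjugate z k \<otimes> \<beta> k = \<beta> k \<otimes> conjugate z k"
proof -
  interpret group_hom G G \<beta> by unfold_locales fact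
  have "k \<otimes> conjugate (inv z) (\<beta> k) = conjugate (inv z) (\<beta> k) \<otimes> k"
    by (rule commute_conjugate_of_twisted_cube) (use assms in simp_all)
  then show ?thesis
    using commute_conjugate_iff[of "inv z" k "\<beta> k"] carrier by simp
qed

lemma conjugate_image_commutator_of_twisted_cube:
  assumes "\<beta> \<in> hom G G" and carrier [simp]: "k \<in> carrier G" "z \<in> carrier G"
    and "twisted_cube \<beta> k = \<one>" "twisted_cube \<beta> (inv k) = \<one>" "twisted_cube \<beta> (inv z) = \<one>"
    and "twisted_cube \<beta> (k \<otimes> inv z) = \<one>" "twisted_cube \<beta> (inv k \<otimes> inv z) = \<one>"
  shows "conjugate (\<beta> k) (commutator z k) = commutator z k"
proof -
  interpret group_hom G G \<beta> by unfold_locales fact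
  interpret conj: group_hom G G "conjugate (\<beta> k)"
    by unfold_locales (simp add: conjugate_hom)
  have "conjugate (\<beta> k) k = k"
    using commute_image_of_twisted_cube[of \<beta> k] assms
    by (simp add: conjugate_eq_self_iff commutator_eq_one_iff)
  moreover have "conjugate (\<beta> k) (conjugate z k) = conjugate z k"
    using commute_image_conjugate_of_twisted_cube[of \<beta> k z] assms
    by (simp add: conjugate_eq_self_iff commutator_eq_one_iff)
  ultimately show ?thesis by (simp add: commutator_eq_conjugate_mult)
qed

lemma twisted_cube_mult_eq_one:
  assumes "\<beta> \<in> hom G G" and carrier: "z \<in> carrier G" "k \<in> carrier G"
    and "twisted_cube \<beta> k = \<one>" "twisted_cube \<beta> (z \<otimes> k) = \<one>"
  shows "conjugate (inv k) z \<otimes> \<beta> z \<otimes> conjugate (\<beta> k) (\<beta> (\<beta> z)) = \<one>"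
proof -
  interpret group_hom G G \<beta> by unfold_locales fact
  have "conjugate (inv k) z \<otimes> \<beta> z \<otimes> conjugate (\<beta> k) (\<beta> (\<beta> z))
      = conjugate (inv k) (twisted_cube (conjugate k \<circ> \<beta>) z)"
    unfolding twisted_cube_def conjugate_def using carrier by (simp add: word_simps)
  also have "twisted_cube (conjugate k \<circ> \<beta>) z = \<one>"
    using twisted_cube_conjugate[of \<beta> z k] assms by simp
  finally show ?thesis
    using carrier by simp
qed

lemma engel_of_twisted_cubes:
  assumes hom: "\<beta> \<in> hom G G" and carrier [simp]: "k \<in> carrier G" "z \<in> carrier G"
    and "\<And>f. f \<in> {z, inv z, k, inv k, z \<otimes> k, z \<otimes> inv k, k \<otimes> inv z, inv k \<otimes> inv z}
      \<Longrightarrow> twisted_cube \<beta> f = \<one>"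
  shows "commutator k (commutator k z) = \<one>"
proof -
  interpret group_hom G G \<beta> by unfold_locales fact
  interpret conj: group_hom G G "conjugate (\<beta> k)"
    by unfold_locales (simp add: conjugate_hom)
  define p q where "p = conjugate (inv k) z" and "q = conjugate k z"
  have [simp]: "p \<in> carrier G" "q \<in> carrier G" unfolding p_def q_def by simp_all
  note cubes = assms(4)
  have "z \<otimes> \<beta> z \<otimes> \<beta> (\<beta> z) = \<one>"
    using cubes[of z] unfolding twisted_cube_def by simp
  then have square_eq: "\<beta> (\<beta> z) = inv (z \<otimes> \<beta> z)"
    by (intro eq_inv_of_mult_eq_one) simp_all
  have "p \<otimes> \<beta> z \<otimes> conjugate (\<beta> k) (\<beta> (\<beta> z)) = \<one>"
    unfolding p_def by (rule twisted_cube_mult_eq_one[OF hom]) (simp_all add: cubes)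
  then have conj_square_eq: "conjugate (\<beta> k) (\<beta> (\<beta> z)) = inv (p \<otimes> \<beta> z)"
    by (intro eq_inv_of_mult_eq_one) simp_all
  have "q \<otimes> \<beta> z \<otimes> conjugate (inv (\<beta> k)) (\<beta> (\<beta> z)) = \<one>"
    unfolding q_def using twisted_cube_mult_eq_one[OF hom, of z "inv k"] by (simp add: cubes)
  then have "conjugate (inv (\<beta> k)) (\<beta> (\<beta> z)) = inv (q \<otimes> \<beta> z)"
    by (intro eq_inv_of_mult_eq_one) simp_all
  then have conj_q_eq: "conjugate (\<beta> k) (inv (q \<otimes> \<beta> z)) = \<beta> (\<beta> z)"
    using conjugate_mult_left[of "\<beta> k" "inv (\<beta> k)" "\<beta> (\<beta> z)"] by simp
  have "commutator z k = inv (\<beta> (\<beta> z)) \<otimes> inv (q \<otimes> \<beta> z)"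
    unfolding square_eq q_def conjugate_def commutator_def by (simp add: word_simps)
  then have "conjugate (\<beta> k) (commutator z k)
      = inv (conjugate (\<beta> k) (\<beta> (\<beta> z))) \<otimes> conjugate (\<beta> k) (inv (q \<otimes> \<beta> z))"
    by simp
  also have "conjugate (\<beta> k) (commutator z k) = commutator z k"
    by (rule conjugate_image_commutator_of_twisted_cube[OF hom]) (simp_all add: cubes)
  also have "inv (conjugate (\<beta> k) (\<beta> (\<beta> z))) \<otimes> conjugate (\<beta> k) (inv (q \<otimes> \<beta> z))
      = inv (inv (p \<otimes> \<beta> z)) \<otimes> \<beta> (\<beta> z)"
    by (simp only: conj_square_eq conj_q_eq)
  also have "\<dots> = inv k \<otimes> conjugate z k"
    unfolding square_eq p_def conjugate_def by (simp add: word_simps)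
  finally show ?thesis
    using commute_inv_iff[of "conjugate z k" k]
    by (simp add: commutator_eq_conjugate_mult[of z] commutator_self_left_eq_one_iff)
qed

end

section \<open>Thick sets\<close>

text \<open>Equivalently, any \<open>n\<close> left translates of \<open>X\<close> have a common point.\<close>

definition thick :: "('a, 'b) monoid_scheme \<Rightarrow> nat \<Rightarrow> 'a set \<Rightarrow> bool" where
  "thick G n X \<longleftrightarrow> (\<forall>F \<subseteq> carrier G. finite F \<longrightarrow> card F \<le> n
     \<longrightarrow> (\<exists>b\<in>carrier G. \<forall>f\<in>F. f \<otimes>\<^bsub>G\<^esub> b \<in> X))"

lemma thick_mono: "thick G n X \<Longrightarrow> k \<le> n \<Longrightarrow> thick G k X"
  unfolding thick_def by (meson le_trans)

lemma thickD:
  assumes "thick G n X" "set fs \<subseteq> carrier G" "length fs \<le> n"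
  shows "\<exists>b\<in>carrier G. \<forall>f\<in>set fs. f \<otimes>\<^bsub>G\<^esub> b \<in> X"
  using assms card_length[of fs] unfolding thick_def by (meson le_trans List.finite_set)

lemma (in group) thick_Inter_translates:
  assumes X: "thick G (card E * n) X" and E: "finite E" "E \<subseteq> carrier G"
  shows "thick G n {x \<in> carrier G. \<forall>e\<in>E. e \<otimes> x \<in> X}"
  unfolding thick_def
proof (intro allI impI)
  fix F assume F: "F \<subseteq> carrier G" "finite F" "card F \<le> n"
  let ?EF = "(\<lambda>(e, f). e \<otimes> f) ` (E \<times> F)"
  have "card ?EF \<le> card (E \<times> F)"
    using E F by (intro card_image_le) simp
  also have "\<dots> \<le> card E * n"
    using F by (simp add: card_cartesian_product)
  finally have "card ?EF \<le> card E * n" .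
  moreover have "?EF \<subseteq> carrier G" "finite ?EF"
    using E F by auto
  ultimately obtain b where b: "b \<in> carrier G" "\<forall>d\<in>?EF. d \<otimes> b \<in> X"
    using X unfolding thick_def by blast
  have "e \<otimes> (f \<otimes> b) \<in> X" if "e \<in> E" "f \<in> F" for e f
  proof -
    have "e \<otimes> f \<otimes> b \<in> X" using b(2) that by auto
    then show ?thesis using E(2) F(1) b(1) that by (simp add: m_assoc subset_iff)
  qed
  then have "\<forall>f\<in>F. f \<otimes> b \<in> {x \<in> carrier G. \<forall>e\<in>E. e \<otimes> x \<in> X}"
    using F(1) b(1) by auto
  with b(1) show "\<exists>b\<in>carrier G. \<forall>f\<in>F. f \<otimes> b \<in> {x \<in> carrier G. \<forall>e\<in>E. e \<otimes> x \<in> X}"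
    by blast
qed

lemma (in group_hom) trivial_of_constant_on_thick:
  assumes "thick G 2 Y" "\<And>y. y \<in> Y \<Longrightarrow> h y = c" and x: "x \<in> carrier G"
  shows "h x = \<one>\<^bsub>H\<^esub>"
proof -
  obtain b where b: "b \<in> carrier G" "\<one> \<otimes> b \<in> Y" "x \<otimes> b \<in> Y"
    using thickD[OF assms(1), of "[\<one>, x]"] x by auto
  then have "h x \<otimes>\<^bsub>H\<^esub> h b = h b"
    using assms(2) x by (metis G.l_one hom_mult)
  then show ?thesis using b(1) x by simp
qed

text \<open>Three generic elements span a cube whose vertices other than \<open>\<one>\<close> all lie in \<open>Y\<close>.\<close>

lemma (in group) quadratic_map_trivial_at_one:
  assumes "group A" and f: "quadratic_map G A f"
    and Y: "thick G 4 Y" "\<And>y. y \<in> Y \<Longrightarrow> f y = \<one>\<^bsub>A\<^esub>"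
  shows "f \<one> = \<one>\<^bsub>A\<^esub>"
proof -
  interpret A: group A by fact
  have generic: "\<exists>b\<in>carrier G. \<forall>e\<in>set es. f (e \<otimes> b) = \<one>\<^bsub>A\<^esub>"
    if "set es \<subseteq> carrier G" "length es \<le> 4" for es
    using thickD[OF Y(1) that] Y(2) by blast
  obtain x where x: "x \<in> carrier G" "f x = \<one>\<^bsub>A\<^esub>"
    using generic[of "[\<one>]"] by auto
  obtain y where y: "y \<in> carrier G" "f y = \<one>\<^bsub>A\<^esub>" "f (x \<otimes> y) = \<one>\<^bsub>A\<^esub>"
    using generic[of "[\<one>, x]"] x by auto
  obtain z where z: "z \<in> carrier G" "f z = \<one>\<^bsub>A\<^esub>" "f (x \<otimes> z) = \<one>\<^bsub>A\<^esub>" "f (y \<otimes> z) = \<one>\<^bsub>A\<^esub>"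
    "f (x \<otimes> y \<otimes> z) = \<one>\<^bsub>A\<^esub>"
    using generic[of "[\<one>, x, y, x \<otimes> y]"] x y by auto
  have "f \<one> \<in> carrier A" using f unfolding quadratic_map_def by auto
  moreover have "f (x \<otimes> y \<otimes> z) \<otimes>\<^bsub>A\<^esub> f x \<otimes>\<^bsub>A\<^esub> f y \<otimes>\<^bsub>A\<^esub> f z
      = f (x \<otimes> y) \<otimes>\<^bsub>A\<^esub> f (x \<otimes> z) \<otimes>\<^bsub>A\<^esub> f (y \<otimes> z) \<otimes>\<^bsub>A\<^esub> f \<one>"
    using f x(1) y(1) z(1) unfolding quadratic_map_def by blast
  ultimately show ?thesis unfolding x y z by simp
qed

section \<open>Splitting endomorphisms of order three\<close>

locale thick_splitting_endomorphism = group_hom G G \<alpha> for G (structure) and \<alpha> +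
  assumes order_three: "x \<in> carrier G \<Longrightarrow> \<alpha> (\<alpha> (\<alpha> x)) = x"
    and thick: "thick G 9 {x \<in> carrier G. G.twisted_cube \<alpha> x = \<one>}"
begin

sublocale two_engel_group G
proof
  fix k z assume [simp]: "k \<in> carrier G" "z \<in> carrier G"
  define F where "F = set [\<one>, z, inv z, k, inv k, z \<otimes> k, z \<otimes> inv k, k \<otimes> inv z, inv k \<otimes> inv z]"
  have F: "F \<subseteq> carrier G" unfolding F_def by simp
  then have "\<exists>b\<in>carrier G. \<forall>f\<in>F. f \<otimes> b \<in> {x \<in> carrier G. twisted_cube \<alpha> x = \<one>}"
    unfolding F_def by (intro thickD[OF thick]) simp_all
  then obtain b where b: "b \<in> carrier G"
    and cubes: "\<And>f. f \<in> F \<Longrightarrow> twisted_cube \<alpha> (f \<otimes> b) = \<one>" by blast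
  have "twisted_cube \<alpha> b = \<one>"
    using cubes[of \<one>] b unfolding F_def by simp
  then have "twisted_cube (conjugate b \<circ> \<alpha>) f = \<one>" if "f \<in> F" for f
    using twisted_cube_conjugate[OF homh _ b] cubes that F by auto
  then show "commutator k (commutator k z) = \<one>"
    by (intro engel_of_twisted_cubes[OF conjugate_comp_hom[OF homh b]]) (auto simp: F_def)
qed

lemma thick_Inter_translates_twisted_cube:
  assumes E: "finite E" "E \<subseteq> carrier G" "card E * n \<le> 9"
  shows "thick G n {x \<in> carrier G. \<forall>e\<in>E. twisted_cube \<alpha> (e \<otimes> x) = \<one>}"
proof -
  have "{x \<in> carrier G. \<forall>e\<in>E. e \<otimes> x \<in> {y \<in> carrier G. twisted_cube \<alpha> y = \<one>}}
      = {x \<in> carrier G. \<forall>e\<in>E. twisted_cube \<alpha> (e \<otimes> x) = \<one>}"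
    using E(2) by auto
  then show ?thesis
    using thick_Inter_translates[OF thick_mono[OF thick E(3)] E(1,2)] by simp
qed

lemma double_commutator_eq_of_twisted_cubes:
  assumes [simp]: "g \<in> carrier G" "y \<in> carrier G"
    and cubes: "twisted_cube \<alpha> y = \<one>" "twisted_cube \<alpha> (g \<otimes> y) = \<one>" "twisted_cube \<alpha> (inv g \<otimes> y) = \<one>"
  shows "commutator g (commutator y (\<alpha> g)) = inv (commutator g (\<alpha> g))"
proof -
  define u where "u = commutator y (\<alpha> g)"
  define c where "c = commutator g (\<alpha> g)"
  have [simp]: "u \<in> carrier G" "c \<in> carrier G" unfolding u_def c_def by simp_all
  have "commutator g (conjugate y (\<alpha> g)) = \<one>"
    using commute_conjugate_of_twisted_cube[OF homh _ _ cubes] by (simp add: commutator_eq_one_iff)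
  then have "commutator g u \<otimes> conjugate u c = \<one>"
    by (simp add: conjugate_eq_commutator_mult[of y] commutator_mult_right u_def c_def)
  moreover have "conjugate u (commutator g u) = commutator g u"
    using triple_commutator_eq_one[of u g y "\<alpha> g"] by (simp add: conjugate_eq_self_iff u_def)
  ultimately have "conjugate u (commutator g u \<otimes> c) = \<one>"
    by (simp add: conjugate_mult_right)
  then have "commutator g u \<otimes> c = \<one>"
    unfolding conjugate_def by (simp add: inv_solve_right')
  then show ?thesis
    unfolding u_def[symmetric] c_def[symmetric] using inv_equality by simp
qed

lemma commute_conjugate_image:
  assumes [simp]: "g \<in> carrier G" "h \<in> carrier G"
  shows "g \<otimes> conjugate h (\<alpha> g) = conjugate h (\<alpha> g) \<otimes> g"
proof -
  define \<phi> where "\<phi> x = commutator g (commutator x (\<alpha> g))" for x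
  interpret \<phi>: group_hom G G \<phi>
    by unfold_locales (auto intro!: homI simp: \<phi>_def double_commutator_mult_middle)
  define Y where "Y = {x \<in> carrier G. \<forall>e\<in>{\<one>, g, inv g}. twisted_cube \<alpha> (e \<otimes> x) = \<one>}"
  have thick_Y: "thick G 2 Y"
    unfolding Y_def
    by (rule thick_Inter_translates_twisted_cube) (simp_all add: card_insert_if)
  have \<phi>_Y: "\<phi> y = inv (commutator g (\<alpha> g))" if "y \<in> Y" for y
    using that unfolding \<phi>_def Y_def by (intro double_commutator_eq_of_twisted_cubes) auto
  have trivial: "\<phi> x = \<one>" if "x \<in> carrier G" for x
    using \<phi>.trivial_of_constant_on_thick[OF thick_Y \<phi>_Y that] .
  obtain y where "y \<in> Y" "y \<in> carrier G"
    using thickD[OF thick_Y, of "[\<one>]"] by auto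
  then have "commutator g (\<alpha> g) = \<one>"
    using \<phi>_Y[of y] trivial[of y] by (metis assms(1) commutator_closed hom_closed inv_eq_1_iff)
  moreover have "commutator g (conjugate h (\<alpha> g))
      = \<phi> h \<otimes> conjugate (commutator h (\<alpha> g)) (commutator g (\<alpha> g))"
    by (simp add: \<phi>_def conjugate_eq_commutator_mult[of h] commutator_mult_right)
  ultimately have "commutator g (conjugate h (\<alpha> g)) = \<one>"
    using trivial[of h] by simp
  then show ?thesis by (simp add: commutator_eq_one_iff)
qed

lemma orbit_subset_abelian_normal:
  assumes g: "g \<in> carrier G"
  shows "\<exists>A. abelian_normal A G \<and> {g, \<alpha> g, \<alpha> (\<alpha> g)} \<subseteq> A"
proof (rule ex_abelian_normal)
  fix x a b
  assume x: "x \<in> carrier G" and ab: "a \<in> {g, \<alpha> g, \<alpha> (\<alpha> g)}" "b \<in> {g, \<alpha> g, \<alpha> (\<alpha> g)}"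
  have [simp]: "a \<in> carrier G" using ab g by auto
  have "\<alpha> (\<alpha> a) \<otimes> conjugate (inv x) a = conjugate (inv x) a \<otimes> \<alpha> (\<alpha> a)"
    using commute_conjugate_image[of "\<alpha> (\<alpha> a)" "inv x"] x by (simp add: order_three)
  then have "a \<otimes> conjugate x (\<alpha> (\<alpha> a)) = conjugate x (\<alpha> (\<alpha> a)) \<otimes> a"
    using commute_conjugate_iff[of x a "\<alpha> (\<alpha> a)"] x by simp
  moreover have "b \<in> {a, \<alpha> a, \<alpha> (\<alpha> a)}"
    using ab g order_three by auto
  ultimately show "a \<otimes> conjugate x b = conjugate x b \<otimes> a"
    using commute_conjugate[of a x] commute_conjugate_image[of a x] x by auto
qed (use g in auto)

theorem twisted_cube_eq_one:
  assumes g [simp]: "g \<in> carrier G"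
  shows "twisted_cube \<alpha> g = \<one>"
proof -
  obtain A where "abelian_normal A G" and orbit: "g \<in> A" "\<alpha> g \<in> A" "\<alpha> (\<alpha> g) \<in> A"
    using orbit_subset_abelian_normal[OF g] by auto
  then interpret A: two_engel_abelian_normal G A
    by (simp add: two_engel_abelian_normal_def two_engel_group_axioms)
  interpret comm_A: comm_group "G\<lparr>carrier := A\<rparr>" by (rule A.comm_group_subgroup)
  define M where "M x = g \<otimes> conjugate x (\<alpha> g) \<otimes> conjugate (x \<otimes> \<alpha> x) (\<alpha> (\<alpha> g))" for x
  have quadratic: "quadratic_map G (G\<lparr>carrier := A\<rparr>) M"
    unfolding M_def
    using comm_A.quadratic_map_mult[OF is_group] comm_A.quadratic_map_const[of g G]
      A.quadratic_map_conjugate A.quadratic_map_conjugate_twist[OF homh] orbit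
    by simp
  have M_eq: "M x = twisted_cube \<alpha> (g \<otimes> x)" if "x \<in> carrier G" "twisted_cube \<alpha> x = \<one>" for x
  proof -
    have "M x = twisted_cube (conjugate x \<circ> \<alpha>) g"
      unfolding M_def twisted_cube_def using that(1) by (simp add: hom_conjugate conjugate_mult_left)
    then show ?thesis using twisted_cube_conjugate[OF homh g that] by simp
  qed
  define Y where "Y = {x \<in> carrier G. \<forall>e\<in>{\<one>, g}. twisted_cube \<alpha> (e \<otimes> x) = \<one>}"
  have "thick G 4 Y"
    unfolding Y_def
    by (rule thick_Inter_translates_twisted_cube) (simp_all add: card_insert_if)
  moreover have "M x = \<one>" if "x \<in> Y" for x
    using M_eq[of x] that unfolding Y_def by auto
  ultimately have "M \<one> = \<one>"
    using quadratic_map_trivial_at_one[OF comm_A.is_group quadratic] by simp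
  then show ?thesis
    unfolding M_def twisted_cube_def by simp
qed

end

section \<open>Haar measure\<close>

lemma (in finite_measure) ex_common_point:
  assumes "finite F" and A: "\<And>f. f \<in> F \<Longrightarrow> A f \<in> sets M"
    and "(\<Sum>f\<in>F. measure M (space M - A f)) < measure M (space M)"
  shows "\<exists>x\<in>space M. \<forall>f\<in>F. x \<in> A f"
proof (rule ccontr)
  assume "\<not> ?thesis"
  then have "space M \<subseteq> (\<Union>f\<in>F. space M - A f)" by blast
  then have "measure M (space M) \<le> measure M (\<Union>f\<in>F. space M - A f)"
    using assms(1) A by (intro finite_measure_mono sets.finite_UN) auto
  also have "\<dots> \<le> (\<Sum>f\<in>F. measure M (space M - A f))"
    using assms by (intro finite_measure_subadditive_finite) auto
  finally show False using assms(3) by simp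
qed

lemma thick_of_haar_measure:
  assumes "group G" and haar: "normalized_haar_measure G T m"
    and X: "X \<in> sets m" "real n * (1 - measure m X) < 1"
  shows "thick G n X"
  unfolding thick_def
proof (intro allI impI)
  interpret group G by fact
  have space: "emeasure m (space m) = 1" "space m = carrier G"
    using haar unfolding normalized_haar_measure_def by auto
  interpret finite_measure m by (rule finite_measureI) (simp add: space(1))
  have total: "measure m (space m) = 1" unfolding measure_def space(1) by simp
  fix F assume F: "F \<subseteq> carrier G" "finite F" "card F \<le> n"
  define A where "A f = inv\<^bsub>G\<^esub> f <#\<^bsub>G\<^esub> X" for f
  have A: "A f \<in> sets m" "measure m (A f) = measure m X" if "f \<in> F" for f
  proof -
    have "inv\<^bsub>G\<^esub> f \<in> carrier G" using F(1) that by auto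
    then have "A f \<in> sets m \<and> emeasure m (A f) = emeasure m X"
      using haar X(1) unfolding normalized_haar_measure_def A_def by blast
    then show "A f \<in> sets m" "measure m (A f) = measure m X"
      by (simp_all add: measure_def)
  qed
  have "(\<Sum>f\<in>F. measure m (space m - A f)) = real (card F) * (1 - measure m X)"
    using A by (simp add: finite_measure_compl total)
  also have "\<dots> \<le> real n * (1 - measure m X)"
    using F(3) bounded_measure[of X] total by (intro mult_right_mono) auto
  also note X(2)
  finally have "\<exists>b\<in>space m. \<forall>f\<in>F. b \<in> A f"
    by (intro ex_common_point F(2) A(1)) (simp_all add: total)
  then obtain b where b: "b \<in> carrier G" "\<And>f. f \<in> F \<Longrightarrow> b \<in> A f"
    unfolding space(2) by blast
  have "f \<otimes>\<^bsub>G\<^esub> b \<in> X" if f: "f \<in> F" for f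
  proof -
    obtain x where "x \<in> X" "b = inv\<^bsub>G\<^esub> f \<otimes>\<^bsub>G\<^esub> x"
      using b(2)[OF f] unfolding A_def l_coset_def by auto
    moreover have "f \<in> carrier G" "x \<in> carrier G"
      using F(1) f sets.sets_into_space[OF X(1)] \<open>x \<in> X\<close> space(2) by auto
    ultimately show ?thesis by (simp add: inv_mult_cancel)
  qed
  with b(1) show "\<exists>b\<in>carrier G. \<forall>f\<in>F. f \<otimes>\<^bsub>G\<^esub> b \<in> X" by blast
qed

theorem theorem3p1:
  fixes G :: "('a, 'b) monoid_scheme" and T :: "'a topology" and m :: "'a measure"
    and \<alpha> :: "'a \<Rightarrow> 'a"
  assumes "compact_hausdorff_group G T"
    and "normalized_haar_measure G T m"
    and "\<alpha> \<in> iso G G"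
    and "\<forall>x \<in> carrier G. \<alpha> (\<alpha> (\<alpha> x)) = x"
    and "{x \<in> carrier G. x \<otimes>\<^bsub>G\<^esub> \<alpha> x \<otimes>\<^bsub>G\<^esub> \<alpha> (\<alpha> x) = \<one>\<^bsub>G\<^esub>} \<in> sets m"
    and "measure m {x \<in> carrier G. x \<otimes>\<^bsub>G\<^esub> \<alpha> x \<otimes>\<^bsub>G\<^esub> \<alpha> (\<alpha> x) = \<one>\<^bsub>G\<^esub>} > 15/16"
  shows "{x \<in> carrier G. x \<otimes>\<^bsub>G\<^esub> \<alpha> x \<otimes>\<^bsub>G\<^esub> \<alpha> (\<alpha> x) = \<one>\<^bsub>G\<^esub>} = carrier G"
proof -
  interpret group G using assms(1) unfolding compact_hausdorff_group_def by simp
  have "thick G 9 {x \<in> carrier G. twisted_cube \<alpha> x = \<one>\<^bsub>G\<^esub>}"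
    unfolding twisted_cube_def
    by (rule thick_of_haar_measure[OF is_group assms(2,5)]) (use assms(6) in simp)
  then interpret thick_splitting_endomorphism G \<alpha>
    using assms(3,4) by unfold_locales (simp_all add: iso_def)
  show ?thesis using twisted_cube_eq_one unfolding twisted_cube_def by blast
qed

end
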